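(* Let $\mathcal T$ be a big tt-category with a good support--cosupport pair $(\mathrm s_\Gamma,\mathrm c_\Gamma)$ induced by $\Gamma\colon S\to\mathrm{Ob}(\mathcal T)$, and let $\mathcal K$ be a costratified $\mathcal T$-module. Then there is a bijective correspondence between $\hom$-prime colocalizing submodules of $\mathcal K$ and points of $\mathrm c_\Gamma^\ast(I_{\mathcal K})$. A point $s\in\mathrm c_\Gamma^\ast(I_{\mathcal K})$ is associated with $$\mathrm{Ker}[\Gamma_s,-]_\ast=\mathrm{coloc}^{\hom}\big([\Gamma_r,I_{\mathcal K}]_\ast\mid r\in S,\ r\neq s\big).$$
   Context: A big tt-category is a rigidly-compactly generated tensor-triangulated category $\mathcal T=(\mathcal T,\otimes,1)$: a tensor-triangulated category with arbitrary coproducts (preserved by $\otimes$ in each variable), generated as a localizing subcategory by its compact objects, whose compact objects form an essentially small tensor-triangulated subcategory and coincide with the rigid objects. Its internal hom is $[-,-]$. A $\mathcal T$-module is a compactly generated triangulated category $\mathcal K$ with an action $\ast\colon\mathcal T\times\mathcal K\to\mathcal K$, a functor that is triangulated and coproduct-preserving in each variable, with natural isomorphisms $X\ast(Y\ast A)\cong(X\otimes Y)\ast A$ and $1\ast A\cong A$ satisfying the usual coherence conditions (Stevenson). $[X,-]_\ast$ denotes the right adjoint of $X\ast-$. A colocalizing $\hom$-submodule of $\mathcal K$ is a triangulated subcategory closed under products and under $[X,-]_\ast$ for all $X\in\mathcal T$; $\mathrm{Coloc}^{\hom}(\mathcal K)$ is the collection of these and $\mathrm{coloc}^{\hom}(\mathcal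 A)$ is the smallest one containing $\mathcal A$. $I_{\mathcal K}$ is the product of the Brown--Comenetz duals of the compact objects of $\mathcal K$ (one for each object of a skeleton), the dual of $x$ being the object representing $\mathrm{Hom}_{\mathbb Z}(\mathrm{Hom}_{\mathcal K}(x,-),\mathbb Q/\mathbb Z)$; $\mathcal K$ is the smallest colocalizing subcategory containing $I_{\mathcal K}$. $S$ is a topological space, $\Gamma\colon S\to\mathrm{Ob}(\mathcal T)$ a map; $\mathrm s_\Gamma(X)=\{s\mid\Gamma_s\otimes X\neq0\}$, $\mathrm c_\Gamma(X)=\{s\mid[\Gamma_s,X]\neq0\}$. Good means $\Gamma_s\otimes\Gamma_r=0$ for $s\ne r$ and $\Gamma_s\otimes\Gamma_s\cong\Gamma_s\neq0$ for all $s$. For $A\in\mathcal K$, $\mathrm c_\Gamma^\ast(A)=\{s\in S\mid[\Gamma_s,A]_\ast\neq0\}$. $\mathcal K$ is costratified if the maps $W\mapsto\{A\in\mathcal K\mid\mathrm c_\Gamma^\ast(A)\subseteq W\}$ and $\mathcal C\mapsto\bigcup_{A\in\mathcal C}\mathrm c_\Gamma^\ast(A)$ are mutually inverse bijections between the power set of $\mathrm c_\Gamma^\ast(I_{\mathcal K})$ and $\mathrm{Coloc}^{\hom}(\mathcal K)$. For $\mathcal C\in\mathrm{Coloc}^{\hom}(\mathcal K)$ put $\mathcal C^{\otimes\mathrm C}=\{X\in\mathcal T\mid[X,A]_\ast\in\mathcal C\ \text{for all }A\in\mathcal K\}$. A proper colocalizing $\hom$-submodule $\mathcal C\subsetneq\mathcal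 K$ is $\hom$-prime if, for $X\in\mathcal T$, $A\in\mathcal K$, $[X,A]_\ast\in\mathcal C$ implies $X\in\mathcal C^{\otimes\mathrm C}$ or $A\in\mathcal C$. *)

theory Defs
  imports "HOL-Algebra.Free_Abelian_Groups" "HOL-Analysis.Abstract_Topology"
begin

section \<open>Categories\<close>

text \<open>
  The objects and the arrows of a category are the elements of two types. Composition is
  written in the usual order and is only constrained on composable arrows.
\<close>

record ('o, 'm) cat =
  src :: "'m \<Rightarrow> 'o"
  tgt :: "'m \<Rightarrow> 'o"
  idn :: "'o \<Rightarrow> 'm"
  cmp :: "'m \<Rightarrow> 'm \<Rightarrow> 'm" (infixr \<open>\<cdot>\<index>\<close> 70)

definition Hom :: "('o, 'm, 'z) cat_scheme \<Rightarrow> 'o \<Rightarrow> 'o \<Rightarrow> 'm set" where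
  "Hom C A B = {f. src C f = A \<and> tgt C f = B}"

locale category =
  fixes C :: "('o, 'm, 'z) cat_scheme" (structure)
  assumes idn_Hom: "idn C A \<in> Hom C A A"
    and cmp_Hom: "f \<in> Hom C A B \<Longrightarrow> g \<in> Hom C B D \<Longrightarrow> g \<cdot> f \<in> Hom C A D"
    and idn_left: "f \<in> Hom C A B \<Longrightarrow> idn C B \<cdot> f = f"
    and idn_right: "f \<in> Hom C A B \<Longrightarrow> f \<cdot> idn C A = f"
    and cmp_assoc: "f \<in> Hom C A B \<Longrightarrow> g \<in> Hom C B D \<Longrightarrow> h \<in> Hom C D E \<Longrightarrow>
      (h \<cdot> g) \<cdot> f = h \<cdot> (g \<cdot> f)"

definition inverse_arrows :: "('o, 'm, 'z) cat_scheme \<Rightarrow> 'm \<Rightarrow> 'm \<Rightarrow> bool" where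
  "inverse_arrows C f g \<longleftrightarrow> g \<in> Hom C (tgt C f) (src C f) \<and>
     g \<cdot>\<^bsub>C\<^esub> f = idn C (src C f) \<and> f \<cdot>\<^bsub>C\<^esub> g = idn C (tgt C f)"

definition isos :: "('o, 'm, 'z) cat_scheme \<Rightarrow> 'o \<Rightarrow> 'o \<Rightarrow> 'm set" where
  "isos C A B = {f \<in> Hom C A B. \<exists>g. inverse_arrows C f g}"

definition arr_inv :: "('o, 'm, 'z) cat_scheme \<Rightarrow> 'm \<Rightarrow> 'm" where
  "arr_inv C f = (THE g. inverse_arrows C f g)"

definition isomorphic :: "('o, 'm, 'z) cat_scheme \<Rightarrow> 'o \<Rightarrow> 'o \<Rightarrow> bool" where
  "isomorphic C A B \<longleftrightarrow> isos C A B \<noteq> {}"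

definition zero_obj :: "('o, 'm, 'z) cat_scheme \<Rightarrow> 'o \<Rightarrow> bool" where
  "zero_obj C Z \<longleftrightarrow> (\<forall>A. (\<exists>!f. f \<in> Hom C Z A) \<and> (\<exists>!f. f \<in> Hom C A Z))"

definition is_coproduct ::
  "('o, 'm, 'z) cat_scheme \<Rightarrow> 'i set \<Rightarrow> ('i \<Rightarrow> 'o) \<Rightarrow> 'o \<Rightarrow> ('i \<Rightarrow> 'm) \<Rightarrow> bool" where
  "is_coproduct C I X P inc \<longleftrightarrow> (\<forall>i\<in>I. inc i \<in> Hom C (X i) P) \<and>
     (\<forall>Y f. (\<forall>i\<in>I. f i \<in> Hom C (X i) Y) \<longrightarrow>
       (\<exists>!h. h \<in> Hom C P Y \<and> (\<forall>i\<in>I. h \<cdot>\<^bsub>C\<^esub> inc i = f i)))"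

definition is_product ::
  "('o, 'm, 'z) cat_scheme \<Rightarrow> 'i set \<Rightarrow> ('i \<Rightarrow> 'o) \<Rightarrow> 'o \<Rightarrow> ('i \<Rightarrow> 'm) \<Rightarrow> bool" where
  "is_product C I X P pr \<longleftrightarrow> (\<forall>i\<in>I. pr i \<in> Hom C P (X i)) \<and>
     (\<forall>Y f. (\<forall>i\<in>I. f i \<in> Hom C Y (X i)) \<longrightarrow>
       (\<exists>!h. h \<in> Hom C Y P \<and> (\<forall>i\<in>I. pr i \<cdot>\<^bsub>C\<^esub> h = f i)))"

definition is_functor :: "('o, 'm, 'z) cat_scheme \<Rightarrow> ('p, 'n, 'y) cat_scheme \<Rightarrow>
    ('o \<Rightarrow> 'p) \<Rightarrow> ('m \<Rightarrow> 'n) \<Rightarrow> bool" where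
  "is_functor C D FO FM \<longleftrightarrow>
     (\<forall>A B. \<forall>f\<in>Hom C A B. FM f \<in> Hom D (FO A) (FO B)) \<and>
     (\<forall>A. FM (idn C A) = idn D (FO A)) \<and>
     (\<forall>A B E. \<forall>f\<in>Hom C A B. \<forall>g\<in>Hom C B E. FM (g \<cdot>\<^bsub>C\<^esub> f) = FM g \<cdot>\<^bsub>D\<^esub> FM f)"

definition right_adjoint :: "('o, 'm, 'z) cat_scheme \<Rightarrow> ('p, 'n, 'y) cat_scheme \<Rightarrow>
    ('o \<Rightarrow> 'p) \<Rightarrow> ('m \<Rightarrow> 'n) \<Rightarrow> ('p \<Rightarrow> 'o) \<Rightarrow> ('n \<Rightarrow> 'm) \<Rightarrow> bool" where
  "right_adjoint C D FO FM GO GM \<longleftrightarrow>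
     is_functor C D FO FM \<and> is_functor D C GO GM \<and>
     (\<exists>\<Phi>. (\<forall>A B. bij_betw (\<Phi> A B) (Hom D (FO A) B) (Hom C A (GO B))) \<and>
       (\<forall>A A' B B'. \<forall>u\<in>Hom C A' A. \<forall>f\<in>Hom D (FO A) B. \<forall>v\<in>Hom D B B'.
          \<Phi> A' B' (v \<cdot>\<^bsub>D\<^esub> f \<cdot>\<^bsub>D\<^esub> FM u) = GM v \<cdot>\<^bsub>C\<^esub> \<Phi> A B f \<cdot>\<^bsub>C\<^esub> u))"


section \<open>Triangulated categories\<close>

text \<open>\<open>tri\<close> is the class of distinguished triangles \<open>X \<rightarrow> Y \<rightarrow> Z \<rightarrow> \<Sigma>X\<close>, given by their three arrows.\<close>

record ('o, 'm) tricat = "('o, 'm) cat" +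
  padd :: "'m \<Rightarrow> 'm \<Rightarrow> 'm"
  zmor :: "'o \<Rightarrow> 'o \<Rightarrow> 'm"
  sus :: "'o \<Rightarrow> 'o"
  susm :: "'m \<Rightarrow> 'm"
  tri :: "('m \<times> 'm \<times> 'm) set"

definition hom_group :: "('o, 'm, 'z) tricat_scheme \<Rightarrow> 'o \<Rightarrow> 'o \<Rightarrow> 'm monoid" where
  "hom_group C A B = \<lparr>carrier = Hom C A B, monoid.mult = padd C, one = zmor C A B\<rparr>"

definition nmor :: "('o, 'm, 'z) tricat_scheme \<Rightarrow> 'm \<Rightarrow> 'm" where
  "nmor C f = inv\<^bsub>hom_group C (src C f) (tgt C f)\<^esub> f"

definition additive_functor :: "('o, 'm, 'z) tricat_scheme \<Rightarrow> ('p, 'n, 'y) tricat_scheme \<Rightarrow>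
    ('o \<Rightarrow> 'p) \<Rightarrow> ('m \<Rightarrow> 'n) \<Rightarrow> bool" where
  "additive_functor C D FO FM \<longleftrightarrow> is_functor C D FO FM \<and>
     (\<forall>A B. \<forall>f\<in>Hom C A B. \<forall>g\<in>Hom C A B. FM (padd C f g) = padd D (FM f) (FM g))"

locale additive_category = category C
  for C :: "('o, 'm, 'z) tricat_scheme" (structure) +
  assumes hom_comm_group: "comm_group (hom_group C A B)"
    and cmp_padd_left: "f \<in> Hom C A B \<Longrightarrow> g \<in> Hom C B D \<Longrightarrow> g' \<in> Hom C B D \<Longrightarrow>
      padd C g g' \<cdot> f = padd C (g \<cdot> f) (g' \<cdot> f)"
    and cmp_padd_right: "f \<in> Hom C A B \<Longrightarrow> f' \<in> Hom C A B \<Longrightarrow> g \<in> Hom C B D \<Longrightarrow>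
      g \<cdot> padd C f f' = padd C (g \<cdot> f) (g \<cdot> f')"
    and ex_zero_obj: "\<exists>Z. zero_obj C Z"
    and ex_binary_product: "\<exists>P pr. is_product C (UNIV :: bool set) (\<lambda>b. if b then A else B) P pr"

text \<open>The suspension is only required to be an auto-equivalence.\<close>

locale triangulated_category = additive_category C
  for C :: "('o, 'm, 'z) tricat_scheme" (structure) +
  assumes sus_additive: "additive_functor C C (sus C) (susm C)"
    and sus_fully_faithful: "bij_betw (susm C) (Hom C A B) (Hom C (sus C A) (sus C B))"
    and sus_ess_surj: "\<exists>B. isomorphic C (sus C B) A"
    and tri_wf: "(f, g, h) \<in> tri C \<Longrightarrow>
      tgt C f = src C g \<and> tgt C g = src C h \<and> tgt C h = sus C (src C f)"
    and TR1_iso: "\<lbrakk>(f, g, h) \<in> tri C;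
        f' \<in> Hom C X' Y'; g' \<in> Hom C Y' Z'; h' \<in> Hom C Z' (sus C X');
        u \<in> isos C (src C f) X'; v \<in> isos C (src C g) Y'; w \<in> isos C (src C h) Z';
        v \<cdot> f = f' \<cdot> u; w \<cdot> g = g' \<cdot> v; susm C u \<cdot> h = h' \<cdot> w\<rbrakk> \<Longrightarrow> (f', g', h') \<in> tri C"
    and TR1_idn: "zero_obj C Z \<Longrightarrow> (idn C X, zmor C X Z, zmor C Z (sus C X)) \<in> tri C"
    and TR1_cone: "\<exists>g h. (f, g, h) \<in> tri C"
    and TR2: "\<lbrakk>f \<in> Hom C X Y; g \<in> Hom C Y Z; h \<in> Hom C Z (sus C X)\<rbrakk> \<Longrightarrow>
      (f, g, h) \<in> tri C \<longleftrightarrow> (g, h, nmor C (susm C f)) \<in> tri C"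
    and TR3: "\<lbrakk>(f, g, h) \<in> tri C; (f', g', h') \<in> tri C;
        u \<in> Hom C (src C f) (src C f'); v \<in> Hom C (src C g) (src C g'); v \<cdot> f = f' \<cdot> u\<rbrakk> \<Longrightarrow>
      \<exists>w \<in> Hom C (src C h) (src C h'). w \<cdot> g = g' \<cdot> v \<and> susm C u \<cdot> h = h' \<cdot> w"
    and TR4: "\<lbrakk>f \<in> Hom C X Y; g \<in> Hom C Y Z;
        (f, a, a') \<in> tri C; (g, b, b') \<in> tri C; (g \<cdot> f, c, c') \<in> tri C\<rbrakk> \<Longrightarrow>
      \<exists>p \<in> Hom C (tgt C a) (tgt C c). \<exists>q \<in> Hom C (tgt C c) (tgt C b).
        (p, q, susm C a \<cdot> b') \<in> tri C \<and>
        p \<cdot> a = c \<cdot> g \<and> c' \<cdot> p = a' \<and> q \<cdot> c = b \<and> b' \<cdot> q = susm C f \<cdot> c'"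

text \<open>A triangulated functor consists of a functor together with an isomorphism
  \<open>\<phi> A : F (\<Sigma>A) \<rightarrow> \<Sigma>(F A)\<close>, natural in \<open>A\<close>.\<close>

definition triangulated_functor ::
  "('o, 'm, 'z) tricat_scheme \<Rightarrow> ('p, 'n, 'y) tricat_scheme \<Rightarrow>
    ('o \<Rightarrow> 'p) \<Rightarrow> ('m \<Rightarrow> 'n) \<Rightarrow> ('o \<Rightarrow> 'n) \<Rightarrow> bool" where
  "triangulated_functor C D FO FM \<phi> \<longleftrightarrow> additive_functor C D FO FM \<and>
     (\<forall>A. \<phi> A \<in> isos D (FO (sus C A)) (sus D (FO A))) \<and>
     (\<forall>A B. \<forall>f\<in>Hom C A B. \<phi> B \<cdot>\<^bsub>D\<^esub> FM (susm C f) = susm D (FM f) \<cdot>\<^bsub>D\<^esub> \<phi> A) \<and>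
     (\<forall>f g h. (f, g, h) \<in> tri C \<longrightarrow> (FM f, FM g, \<phi> (src C f) \<cdot>\<^bsub>D\<^esub> FM h) \<in> tri D)"

text \<open>Full triangulated subcategories are given by their sets of objects and are replete.\<close>

definition triangulated_subcategory :: "('o, 'm, 'z) tricat_scheme \<Rightarrow> 'o set \<Rightarrow> bool" where
  "triangulated_subcategory C L \<longleftrightarrow>
     (\<forall>Z. zero_obj C Z \<longrightarrow> Z \<in> L) \<and>
     (\<forall>A B. A \<in> L \<longrightarrow> isomorphic C A B \<longrightarrow> B \<in> L) \<and>
     (\<forall>A. sus C A \<in> L \<longleftrightarrow> A \<in> L) \<and>
     (\<forall>f g h. (f, g, h) \<in> tri C \<longrightarrow> src C f \<in> L \<longrightarrow> tgt C f \<in> L \<longrightarrow> tgt C g \<in> L)"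


section \<open>Smallness and compact generation\<close>

text \<open>
  Smallness is relative to a type \<open>'u\<close>: a set is small if its cardinality is strictly below that
  of \<open>'u\<close>. If \<open>'u\<close> is a type of inaccessible cardinality, these are the small sets for
  the corresponding Grothendieck universe. Up to reindexing, every small family is indexed by a
  subset of \<open>'u\<close>.
\<close>

definition small :: "'u itself \<Rightarrow> 'a set \<Rightarrow> bool" where
  "small U I \<longleftrightarrow> I \<prec> (UNIV :: 'u set)"

definition has_coproducts :: "'u itself \<Rightarrow> ('o, 'm, 'z) cat_scheme \<Rightarrow> bool" where
  "has_coproducts U C \<longleftrightarrow> (\<forall>(I :: 'u set) X. small U I \<longrightarrow> (\<exists>P inc. is_coproduct C I X P inc))"

definition preserves_coproducts :: "'u itself \<Rightarrow> ('o, 'm, 'z) cat_scheme \<Rightarrow>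
    ('p, 'n, 'y) cat_scheme \<Rightarrow> ('o \<Rightarrow> 'p) \<Rightarrow> ('m \<Rightarrow> 'n) \<Rightarrow> bool" where
  "preserves_coproducts U C D FO FM \<longleftrightarrow>
     (\<forall>(I :: 'u set) X P inc. small U I \<longrightarrow> is_coproduct C I X P inc \<longrightarrow>
        is_coproduct D I (\<lambda>i. FO (X i)) (FO P) (\<lambda>i. FM (inc i)))"

text \<open>\<open>x\<close> is compact if the canonical map
  \<open>\<Oplus>\<^sub>i Hom(x, X\<^sub>i) \<rightarrow> Hom(x, \<Coprod>\<^sub>i X\<^sub>i)\<close> is an isomorphism of groups.
  (The group operation is written multiplicatively by the library, whence \<open>gfinprod\<close>.)\<close>

definition compact_obj :: "'u itself \<Rightarrow> ('o, 'm, 'z) tricat_scheme \<Rightarrow> 'o \<Rightarrow> bool" where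
  "compact_obj U C x \<longleftrightarrow>
     (\<forall>(I :: 'u set) X P inc. small U I \<longrightarrow> is_coproduct C I X P inc \<longrightarrow>
        (\<lambda>f. gfinprod (hom_group C x P) (\<lambda>i. inc i \<cdot>\<^bsub>C\<^esub> f i) I)
          \<in> iso (sum_group I (\<lambda>i. hom_group C x (X i))) (hom_group C x P))"

definition is_skeleton :: "('o, 'm, 'z) cat_scheme \<Rightarrow> 'o set \<Rightarrow> 'o set \<Rightarrow> bool" where
  "is_skeleton C L Sk \<longleftrightarrow> Sk \<subseteq> L \<and> (\<forall>x\<in>L. \<exists>!y. y \<in> Sk \<and> isomorphic C x y)"

definition essentially_small :: "'u itself \<Rightarrow> ('o, 'm, 'z) cat_scheme \<Rightarrow> 'o set \<Rightarrow> bool" where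
  "essentially_small U C L \<longleftrightarrow> (\<exists>Sk. is_skeleton C L Sk \<and> small U Sk)"

definition localizing :: "'u itself \<Rightarrow> ('o, 'm, 'z) tricat_scheme \<Rightarrow> 'o set \<Rightarrow> bool" where
  "localizing U C L \<longleftrightarrow> triangulated_subcategory C L \<and>
     (\<forall>(I :: 'u set) X P inc. small U I \<longrightarrow> (\<forall>i\<in>I. X i \<in> L) \<longrightarrow>
        is_coproduct C I X P inc \<longrightarrow> P \<in> L)"

definition compactly_generated :: "'u itself \<Rightarrow> ('o, 'm, 'z) tricat_scheme \<Rightarrow> bool" where
  "compactly_generated U C \<longleftrightarrow> triangulated_category C \<and> has_coproducts U C \<and>
     essentially_small U C {x. compact_obj U C x} \<and>
     (\<forall>L. localizing U C L \<longrightarrow> {x. compact_obj U C x} \<subseteq> L \<longrightarrow> L = UNIV)"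


section \<open>Tensor-triangulated categories and their actions\<close>

text \<open>
  The data of an action of \<open>T\<close> on \<open>K\<close>: a bifunctor, the isomorphisms
  \<open>\<Sigma>X \<star> A \<rightarrow> \<Sigma>(X \<star> A)\<close> (\<open>sus1\<close>) and \<open>X \<star> \<Sigma>A \<rightarrow> \<Sigma>(X \<star> A)\<close> (\<open>sus2\<close>) making it triangulated
  in each variable, the associator \<open>(X \<otimes> Y) \<star> A \<rightarrow> X \<star> (Y \<star> A)\<close> and the unitor
  \<open>1 \<star> A \<rightarrow> A\<close>.
\<close>

record ('to, 'tm, 'ko, 'km) action =
  obj :: "'to \<Rightarrow> 'ko \<Rightarrow> 'ko" (infixr \<open>\<star>\<index>\<close> 75)
  arr :: "'tm \<Rightarrow> 'km \<Rightarrow> 'km"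
  sus1 :: "'to \<Rightarrow> 'ko \<Rightarrow> 'km"
  sus2 :: "'to \<Rightarrow> 'ko \<Rightarrow> 'km"
  assoc :: "'to \<Rightarrow> 'to \<Rightarrow> 'ko \<Rightarrow> 'km"
  unitor :: "'ko \<Rightarrow> 'km"

text \<open>
  The tensor product of a tensor category \<open>T\<close> is encoded as an action \<open>P\<close> of \<open>T\<close> on itself; its
  right unitor \<open>X \<otimes> 1 \<rightarrow> X\<close> is the composite of the braiding \<open>br\<close> and the left unitor.
\<close>

definition runitor :: "('to, 'tm, 'z) cat_scheme \<Rightarrow> ('to, 'tm, 'to, 'tm) action \<Rightarrow> 'to \<Rightarrow>
    ('to \<Rightarrow> 'to \<Rightarrow> 'tm) \<Rightarrow> 'to \<Rightarrow> 'tm" where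
  "runitor T P e br X = unitor P X \<cdot>\<^bsub>T\<^esub> br X e"

locale tt_action =
  fixes U :: "'u itself"
    and T :: "('to, 'tm, 'z) tricat_scheme"
    and P :: "('to, 'tm, 'to, 'tm) action"
    and e :: 'to
    and br :: "'to \<Rightarrow> 'to \<Rightarrow> 'tm"
    and K :: "('ko, 'km, 'y) tricat_scheme"
    and M :: "('to, 'tm, 'ko, 'km) action"
  assumes arr_Hom: "u \<in> Hom T X Y \<Longrightarrow> f \<in> Hom K A B \<Longrightarrow>
      arr M u f \<in> Hom K (X \<star>\<^bsub>M\<^esub> A) (Y \<star>\<^bsub>M\<^esub> B)"
    and arr_idn: "arr M (idn T X) (idn K A) = idn K (X \<star>\<^bsub>M\<^esub> A)"
    and arr_cmp: "\<lbrakk>u \<in> Hom T X Y; v \<in> Hom T Y Z; f \<in> Hom K A B; g \<in> Hom K B D\<rbrakk> \<Longrightarrow>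
      arr M (v \<cdot>\<^bsub>T\<^esub> u) (g \<cdot>\<^bsub>K\<^esub> f) = arr M v g \<cdot>\<^bsub>K\<^esub> arr M u f"
    and triangulated1: "triangulated_functor T K
      (\<lambda>X. X \<star>\<^bsub>M\<^esub> A) (\<lambda>u. arr M u (idn K A)) (\<lambda>X. sus1 M X A)"
    and triangulated2: "triangulated_functor K K
      (\<lambda>A. X \<star>\<^bsub>M\<^esub> A) (\<lambda>f. arr M (idn T X) f) (\<lambda>A. sus2 M X A)"
    and coproducts1: "preserves_coproducts U T K (\<lambda>X. X \<star>\<^bsub>M\<^esub> A) (\<lambda>u. arr M u (idn K A))"
    and coproducts2: "preserves_coproducts U K K (\<lambda>A. X \<star>\<^bsub>M\<^esub> A) (\<lambda>f. arr M (idn T X) f)"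
    and sus1_natural: "\<lbrakk>u \<in> Hom T X Y; f \<in> Hom K A B\<rbrakk> \<Longrightarrow>
      sus1 M Y B \<cdot>\<^bsub>K\<^esub> arr M (susm T u) f = susm K (arr M u f) \<cdot>\<^bsub>K\<^esub> sus1 M X A"
    and sus2_natural: "\<lbrakk>u \<in> Hom T X Y; f \<in> Hom K A B\<rbrakk> \<Longrightarrow>
      sus2 M Y B \<cdot>\<^bsub>K\<^esub> arr M u (susm K f) = susm K (arr M u f) \<cdot>\<^bsub>K\<^esub> sus2 M X A"
    \<comment> \<open>the two ways of moving both suspensions out of \<open>\<Sigma>X \<star> \<Sigma>A\<close> differ by a sign\<close>
    and sus_anticommute: "susm K (sus1 M X A) \<cdot>\<^bsub>K\<^esub> sus2 M (sus T X) A =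
      nmor K (susm K (sus2 M X A) \<cdot>\<^bsub>K\<^esub> sus1 M X (sus K A))"
    and assoc_iso: "assoc M X Y A \<in> isos K ((X \<star>\<^bsub>P\<^esub> Y) \<star>\<^bsub>M\<^esub> A) (X \<star>\<^bsub>M\<^esub> Y \<star>\<^bsub>M\<^esub> A)"
    and assoc_natural: "\<lbrakk>u \<in> Hom T X X'; v \<in> Hom T Y Y'; f \<in> Hom K A A'\<rbrakk> \<Longrightarrow>
      assoc M X' Y' A' \<cdot>\<^bsub>K\<^esub> arr M (arr P u v) f = arr M u (arr M v f) \<cdot>\<^bsub>K\<^esub> assoc M X Y A"
    and unitor_iso: "unitor M A \<in> isos K (e \<star>\<^bsub>M\<^esub> A) A"
    and unitor_natural: "f \<in> Hom K A B \<Longrightarrow>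
      unitor M B \<cdot>\<^bsub>K\<^esub> arr M (idn T e) f = f \<cdot>\<^bsub>K\<^esub> unitor M A"
    and pentagon: "assoc M X Y (Z \<star>\<^bsub>M\<^esub> A) \<cdot>\<^bsub>K\<^esub> assoc M (X \<star>\<^bsub>P\<^esub> Y) Z A =
      arr M (idn T X) (assoc M Y Z A) \<cdot>\<^bsub>K\<^esub> assoc M X (Y \<star>\<^bsub>P\<^esub> Z) A \<cdot>\<^bsub>K\<^esub>
        arr M (assoc P X Y Z) (idn K A)"
    and triangle: "arr M (idn T X) (unitor M A) \<cdot>\<^bsub>K\<^esub> assoc M X e A =
      arr M (runitor T P e br X) (idn K A)"
    and triangle': "unitor M (X \<star>\<^bsub>M\<^esub> A) \<cdot>\<^bsub>K\<^esub> assoc M e X A = arr M (unitor P X) (idn K A)"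
    and assoc_sus_1: "sus1 M X (Y \<star>\<^bsub>M\<^esub> A) \<cdot>\<^bsub>K\<^esub> assoc M (sus T X) Y A =
      susm K (assoc M X Y A) \<cdot>\<^bsub>K\<^esub> sus1 M (X \<star>\<^bsub>P\<^esub> Y) A \<cdot>\<^bsub>K\<^esub> arr M (sus1 P X Y) (idn K A)"
    and assoc_sus_2:
      "sus2 M X (Y \<star>\<^bsub>M\<^esub> A) \<cdot>\<^bsub>K\<^esub> arr M (idn T X) (sus1 M Y A) \<cdot>\<^bsub>K\<^esub> assoc M X (sus T Y) A =
      susm K (assoc M X Y A) \<cdot>\<^bsub>K\<^esub> sus1 M (X \<star>\<^bsub>P\<^esub> Y) A \<cdot>\<^bsub>K\<^esub> arr M (sus2 P X Y) (idn K A)"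
    and assoc_sus_3:
      "sus2 M X (Y \<star>\<^bsub>M\<^esub> A) \<cdot>\<^bsub>K\<^esub> arr M (idn T X) (sus2 M Y A) \<cdot>\<^bsub>K\<^esub> assoc M X Y (sus K A) =
      susm K (assoc M X Y A) \<cdot>\<^bsub>K\<^esub> sus2 M (X \<star>\<^bsub>P\<^esub> Y) A"
    and unitor_sus: "susm K (unitor M A) \<cdot>\<^bsub>K\<^esub> sus2 M e A = unitor M (sus K A)"

text \<open>A tensor-triangulated category whose coproducts are preserved by the tensor product.\<close>

locale tt_category = triangulated_category T + tt_action U T P e br T P
  for U :: "'u itself"
    and T :: "('to, 'tm, 'z) tricat_scheme"
    and P :: "('to, 'tm, 'to, 'tm) action"
    and e :: 'to
    and br :: "'to \<Rightarrow> 'to \<Rightarrow> 'tm" +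
  assumes br_Hom: "br X Y \<in> Hom T (X \<star>\<^bsub>P\<^esub> Y) (Y \<star>\<^bsub>P\<^esub> X)"
    and br_natural: "\<lbrakk>u \<in> Hom T X X'; v \<in> Hom T Y Y'\<rbrakk> \<Longrightarrow>
      br X' Y' \<cdot>\<^bsub>T\<^esub> arr P u v = arr P v u \<cdot>\<^bsub>T\<^esub> br X Y"
    and br_symmetric: "br Y X \<cdot>\<^bsub>T\<^esub> br X Y = idn T (X \<star>\<^bsub>P\<^esub> Y)"
    and hexagon: "assoc P Y Z X \<cdot>\<^bsub>T\<^esub> br X (Y \<star>\<^bsub>P\<^esub> Z) \<cdot>\<^bsub>T\<^esub> assoc P X Y Z =
      arr P (idn T Y) (br X Z) \<cdot>\<^bsub>T\<^esub> assoc P Y X Z \<cdot>\<^bsub>T\<^esub> arr P (br X Y) (idn T Z)"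
    and br_sus: "susm T (br X Y) \<cdot>\<^bsub>T\<^esub> sus2 P X Y = sus1 P Y X \<cdot>\<^bsub>T\<^esub> br X (sus T Y)"

definition rigid :: "('to, 'tm, 'z) cat_scheme \<Rightarrow> ('to, 'tm, 'to, 'tm) action \<Rightarrow> 'to \<Rightarrow>
    ('to \<Rightarrow> 'to \<Rightarrow> 'tm) \<Rightarrow> 'to \<Rightarrow> bool" where
  "rigid T P e br X \<longleftrightarrow>
     (\<exists>Y. \<exists>ev \<in> Hom T (Y \<star>\<^bsub>P\<^esub> X) e. \<exists>coev \<in> Hom T e (X \<star>\<^bsub>P\<^esub> Y).
        runitor T P e br X \<cdot>\<^bsub>T\<^esub> arr P (idn T X) ev \<cdot>\<^bsub>T\<^esub> assoc P X Y X \<cdot>\<^bsub>T\<^esub> arr P coev (idn T X)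
          = unitor P X \<and>
        unitor P Y \<cdot>\<^bsub>T\<^esub> arr P ev (idn T Y) \<cdot>\<^bsub>T\<^esub> arr_inv T (assoc P Y X Y) \<cdot>\<^bsub>T\<^esub> arr P (idn T Y) coev
          = runitor T P e br Y)"

definition big_tt_category :: "'u itself \<Rightarrow> ('to, 'tm, 'z) tricat_scheme \<Rightarrow>
    ('to, 'tm, 'to, 'tm) action \<Rightarrow> 'to \<Rightarrow> ('to \<Rightarrow> 'to \<Rightarrow> 'tm) \<Rightarrow> bool" where
  "big_tt_category U T P e br \<longleftrightarrow> tt_category U T P e br \<and> compactly_generated U T \<and>
     triangulated_subcategory T {x. compact_obj U T x} \<and>
     compact_obj U T e \<and>
     (\<forall>x y. compact_obj U T x \<longrightarrow> compact_obj U T y \<longrightarrow> compact_obj U T (x \<star>\<^bsub>P\<^esub> y)) \<and>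
     {x. compact_obj U T x} = {x. rigid T P e br x}"

definition tt_module :: "'u itself \<Rightarrow> ('to, 'tm, 'z) tricat_scheme \<Rightarrow>
    ('to, 'tm, 'to, 'tm) action \<Rightarrow> 'to \<Rightarrow> ('to \<Rightarrow> 'to \<Rightarrow> 'tm) \<Rightarrow>
    ('ko, 'km, 'y) tricat_scheme \<Rightarrow> ('to, 'tm, 'ko, 'km) action \<Rightarrow> bool" where
  "tt_module U T P e br K M \<longleftrightarrow> compactly_generated U K \<and> tt_action U T P e br K M"

text \<open>The functors \<open>[X,-]\<^sub>\<star>\<close> are given by chosen right adjoints of \<open>X \<star> -\<close>, with values
  \<open>H X A\<close> on objects and \<open>Hm X f\<close> on arrows.\<close>

definition internal_hom :: "('to, 'tm, 'z) cat_scheme \<Rightarrow> ('ko, 'km, 'y) cat_scheme \<Rightarrow>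
    ('to, 'tm, 'ko, 'km) action \<Rightarrow> ('to \<Rightarrow> 'ko \<Rightarrow> 'ko) \<Rightarrow> ('to \<Rightarrow> 'km \<Rightarrow> 'km) \<Rightarrow> bool" where
  "internal_hom T K M H Hm \<longleftrightarrow>
     (\<forall>X. right_adjoint K K (\<lambda>A. X \<star>\<^bsub>M\<^esub> A) (\<lambda>f. arr M (idn T X) f) (H X) (Hm X))"


section \<open>Brown--Comenetz duals\<close>

definition QZ_group :: "rat set monoid" where
  "QZ_group = \<lparr>carrier = UNIV, monoid.mult = (+), one = 0\<rparr> Mod (\<int> :: rat set)"

definition char_group :: "('a, 'b) monoid_scheme \<Rightarrow> ('a \<Rightarrow> rat set) monoid" where
  "char_group G = \<lparr>carrier = hom G QZ_group \<inter> extensional (carrier G),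
     monoid.mult = (\<lambda>u v. \<lambda>g\<in>carrier G. u g \<otimes>\<^bsub>QZ_group\<^esub> v g),
     one = (\<lambda>g\<in>carrier G. \<one>\<^bsub>QZ_group\<^esub>)\<rparr>"

text \<open>\<open>D\<close> represents the contravariant functor \<open>Hom\<^sub>Z(Hom(x,-),Q/Z)\<close> with values in abelian groups.\<close>

definition brown_comenetz_dual :: "('o, 'm, 'z) tricat_scheme \<Rightarrow> 'o \<Rightarrow> 'o \<Rightarrow> bool" where
  "brown_comenetz_dual K x D \<longleftrightarrow>
     (\<exists>\<phi>. (\<forall>A. \<phi> A \<in> iso (hom_group K A D) (char_group (hom_group K x A))) \<and>
       (\<forall>A A'. \<forall>u\<in>Hom K A' A. \<forall>f\<in>Hom K A D. \<forall>g\<in>Hom K x A'.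
          \<phi> A' (f \<cdot>\<^bsub>K\<^esub> u) g = \<phi> A f (u \<cdot>\<^bsub>K\<^esub> g)))"

definition brown_comenetz_product :: "'u itself \<Rightarrow> ('o, 'm, 'z) tricat_scheme \<Rightarrow> 'o \<Rightarrow> bool" where
  "brown_comenetz_product U K I_K \<longleftrightarrow>
     (\<exists>Sk D pr. is_skeleton K {x. compact_obj U K x} Sk \<and>
        (\<forall>x\<in>Sk. brown_comenetz_dual K x (D x)) \<and> is_product K Sk D I_K pr)"


section \<open>Colocalizing hom-submodules and costratification\<close>

definition Coloc_hom :: "'u itself \<Rightarrow> ('ko, 'km, 'y) tricat_scheme \<Rightarrow> ('to \<Rightarrow> 'ko \<Rightarrow> 'ko) \<Rightarrow>
    'ko set set" where
  "Coloc_hom U K H = {C. triangulated_subcategory K C \<and>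
     (\<forall>(I :: 'u set) A P pr. small U I \<longrightarrow> (\<forall>i\<in>I. A i \<in> C) \<longrightarrow>
        is_product K I A P pr \<longrightarrow> P \<in> C) \<and>
     (\<forall>X. \<forall>A\<in>C. H X A \<in> C)}"

definition coloc_hom :: "'u itself \<Rightarrow> ('ko, 'km, 'y) tricat_scheme \<Rightarrow> ('to \<Rightarrow> 'ko \<Rightarrow> 'ko) \<Rightarrow>
    'ko set \<Rightarrow> 'ko set" where
  "coloc_hom U K H \<A> = \<Inter>{C \<in> Coloc_hom U K H. \<A> \<subseteq> C}"

definition good :: "('to, 'tm, 'z) cat_scheme \<Rightarrow> ('to, 'tm, 'to, 'tm) action \<Rightarrow> 's topology \<Rightarrow>
    ('s \<Rightarrow> 'to) \<Rightarrow> bool" where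
  "good T P S \<Gamma> \<longleftrightarrow>
     (\<forall>s\<in>topspace S. \<forall>r\<in>topspace S. s \<noteq> r \<longrightarrow> zero_obj T (\<Gamma> s \<star>\<^bsub>P\<^esub> \<Gamma> r)) \<and>
     (\<forall>s\<in>topspace S. isomorphic T (\<Gamma> s \<star>\<^bsub>P\<^esub> \<Gamma> s) (\<Gamma> s) \<and> \<not> zero_obj T (\<Gamma> s))"

definition cosupp :: "('ko, 'km, 'y) cat_scheme \<Rightarrow> ('to \<Rightarrow> 'ko \<Rightarrow> 'ko) \<Rightarrow> 's topology \<Rightarrow>
    ('s \<Rightarrow> 'to) \<Rightarrow> 'ko \<Rightarrow> 's set" where
  "cosupp K H S \<Gamma> A = {s \<in> topspace S. \<not> zero_obj K (H (\<Gamma> s) A)}"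

definition costratified :: "'u itself \<Rightarrow> ('ko, 'km, 'y) tricat_scheme \<Rightarrow>
    ('to \<Rightarrow> 'ko \<Rightarrow> 'ko) \<Rightarrow> 's topology \<Rightarrow> ('s \<Rightarrow> 'to) \<Rightarrow> 'ko \<Rightarrow> bool" where
  "costratified U K H S \<Gamma> I_K \<longleftrightarrow>
     (let F = (\<lambda>W. {A. cosupp K H S \<Gamma> A \<subseteq> W});
          G = (\<lambda>C. \<Union>A\<in>C. cosupp K H S \<Gamma> A)
      in F \<in> Pow (cosupp K H S \<Gamma> I_K) \<rightarrow> Coloc_hom U K H \<and>
         G \<in> Coloc_hom U K H \<rightarrow> Pow (cosupp K H S \<Gamma> I_K) \<and>
         (\<forall>W \<in> Pow (cosupp K H S \<Gamma> I_K). G (F W) = W) \<and>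
         (\<forall>C \<in> Coloc_hom U K H. F (G C) = C))"

definition C_otimes :: "('to \<Rightarrow> 'ko \<Rightarrow> 'ko) \<Rightarrow> 'ko set \<Rightarrow> 'to set" where
  "C_otimes H C = {X. \<forall>A. H X A \<in> C}"

definition hom_prime :: "'u itself \<Rightarrow> ('ko, 'km, 'y) tricat_scheme \<Rightarrow> ('to \<Rightarrow> 'ko \<Rightarrow> 'ko) \<Rightarrow>
    'ko set \<Rightarrow> bool" where
  "hom_prime U K H C \<longleftrightarrow> C \<in> Coloc_hom U K H \<and> C \<noteq> UNIV \<and>
     (\<forall>X A. H X A \<in> C \<longrightarrow> X \<in> C_otimes H C \<or> A \<in> C)"

definition ker_hom :: "('ko, 'km, 'y) cat_scheme \<Rightarrow> ('to \<Rightarrow> 'ko \<Rightarrow> 'ko) \<Rightarrow> 'to \<Rightarrow> 'ko set" where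
  "ker_hom K H X = {A. zero_obj K (H X A)}"

end

theory Submission
  imports Defs
begin

text \<open>
  Write \<open>Q\<close> for the cosupport of \<open>I_K\<close>. Costratification says that every colocalizing hom-submodule is
  of the form \<open>{A. csupp A \<subseteq> W}\<close> for a unique \<open>W \<subseteq> Q\<close>; as the whole category is one of them, every
  cosupport lies in \<open>Q\<close>. The kernel of \<open>[\<Gamma>\<^sub>s,-]\<^sub>\<star>\<close> consists of the objects whose cosupport avoids
  \<open>s\<close>, so it is the submodule belonging to \<open>W = Q - {s}\<close>.

  The calculations rest on the equivalence of \<open>[X,[Y,A]\<^sub>\<star>]\<^sub>\<star> = 0\<close> and \<open>[Y \<otimes> X,A]\<^sub>\<star> = 0\<close>
  (\<open>hom_hom_zero_iff\<close>). With goodness of \<open>\<Gamma>\<close> it shows that \<open>[\<Gamma>\<^sub>s,A]\<^sub>\<star>\<close> has cosupport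
  \<open>csupp A \<inter> {s}\<close> (\<open>cosupp_hom_point\<close>): the operation \<open>[\<Gamma>\<^sub>s,-]\<^sub>\<star>\<close> isolates the point \<open>s\<close>.

  For \<open>s \<in> Q\<close> such a kernel is prime (\<open>hom_prime_ker_hom_point\<close>). If \<open>[\<Gamma>\<^sub>s,[X,A]\<^sub>\<star>]\<^sub>\<star> = 0\<close> and
  \<open>[\<Gamma>\<^sub>s,A]\<^sub>\<star> \<noteq> 0\<close>, then the kernel of \<open>[X,-]\<^sub>\<star>\<close> contains \<open>[\<Gamma>\<^sub>s,A]\<^sub>\<star>\<close>, an object with
  cosupport \<open>{s}\<close>. This kernel is itself a colocalizing hom-submodule (\<open>ker_hom_in_Coloc_hom\<close>), so
  it contains all objects with cosupport in \<open>{s}\<close>, in particular every \<open>[\<Gamma>\<^sub>s,B]\<^sub>\<star>\<close>. Thus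
  \<open>[\<Gamma>\<^sub>s,[X,B]\<^sub>\<star>]\<^sub>\<star> = 0\<close> for all \<open>B\<close>.

  Conversely (\<open>hom_prime_is_ker_hom_point\<close>), the set \<open>W\<close> of a prime submodule omits some point of
  \<open>Q\<close>, and it cannot omit two distinct points \<open>s\<close> and \<open>r\<close>: the object
  \<open>[\<Gamma>\<^sub>s,[\<Gamma>\<^sub>r,I_K]\<^sub>\<star>]\<^sub>\<star>\<close> vanishes, while neither \<open>[\<Gamma>\<^sub>r,I_K]\<^sub>\<star>\<close> nor
  \<open>[\<Gamma>\<^sub>s,I_K]\<^sub>\<star>\<close> belongs to the submodule. The same one-point objects show that
  \<open>Ker [\<Gamma>\<^sub>s,-]\<^sub>\<star>\<close> is generated by the \<open>[\<Gamma>\<^sub>r,I_K]\<^sub>\<star>\<close> with \<open>r \<noteq> s\<close>, whose cosupports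
  cover \<open>Q - {s}\<close>.
\<close>

section \<open>Orthogonality in triangulated categories\<close>

text \<open>Vanishing of a group of arrows is expressed by counting, so that it can be carried along
  arbitrary bijections of hom-sets, such as those of an adjunction.\<close>

definition orthogonal :: "('o, 'm, 'z) cat_scheme \<Rightarrow> 'o \<Rightarrow> 'o \<Rightarrow> bool" where
  "orthogonal C A B \<longleftrightarrow> is_singleton (Hom C A B)"

lemma orthogonal_cong_bij:
  assumes "bij_betw \<phi> (Hom C A B) (Hom D A' B')"
  shows "orthogonal C A B \<longleftrightarrow> orthogonal D A' B'"
  using bij_betw_same_card[OF assms] unfolding orthogonal_def is_singleton_altdef by simp

context category
begin

lemma isos_inverse:
  assumes "f \<in> isos C A B"
  obtains g where "g \<in> Hom C B A" "f \<in> Hom C A B" "g \<cdot> f = idn C A" "f \<cdot> g = idn C B"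
  using assms unfolding isos_def inverse_arrows_def Hom_def by auto

lemma isosI:
  assumes "f \<in> Hom C A B" "g \<in> Hom C B A" "g \<cdot> f = idn C A" "f \<cdot> g = idn C B"
  shows "f \<in> isos C A B"
  using assms unfolding isos_def inverse_arrows_def Hom_def by auto

lemma isomorphic_sym: "isomorphic C A B \<Longrightarrow> isomorphic C B A"
  unfolding isomorphic_def by (metis all_not_in_conv isos_inverse isosI)

lemma isomorphic_trans:
  assumes "isomorphic C A B" "isomorphic C B D"
  shows "isomorphic C A D"
proof -
  obtain f f' where f: "f' \<in> Hom C B A" "f \<in> Hom C A B" "f' \<cdot> f = idn C A" "f \<cdot> f' = idn C B"
    using assms(1) unfolding isomorphic_def by (metis all_not_in_conv isos_inverse)
  obtain g g' where g: "g' \<in> Hom C D B" "g \<in> Hom C B D" "g' \<cdot> g = idn C B" "g \<cdot> g' = idn C D"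
    using assms(2) unfolding isomorphic_def by (metis all_not_in_conv isos_inverse)
  have "g \<cdot> f \<in> isos C A D"
  proof (rule isosI[where g = "f' \<cdot> g'"])
    have "g' \<cdot> (g \<cdot> f) = f"
      using cmp_assoc[OF f(2) g(2) g(1)] g(3) idn_left[OF f(2)] by simp
    then show "(f' \<cdot> g') \<cdot> (g \<cdot> f) = idn C A"
      using cmp_assoc[OF cmp_Hom[OF f(2) g(2)] g(1) f(1)] f(3) by simp
    have "f \<cdot> (f' \<cdot> g') = g'"
      using cmp_assoc[OF g(1) f(1) f(2)] f(4) idn_left[OF g(1)] by simp
    then show "(g \<cdot> f) \<cdot> (f' \<cdot> g') = idn C D"
      using cmp_assoc[OF cmp_Hom[OF g(1) f(1)] f(2) g(2)] g(4) by simp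
  qed (fact cmp_Hom[OF f(2) g(2)] cmp_Hom[OF g(1) f(1)])+
  then show ?thesis
    unfolding isomorphic_def by blast
qed

lemma orthogonal_cong_left:
  assumes "isomorphic C A A'"
  shows "orthogonal C A B \<longleftrightarrow> orthogonal C A' B"
proof -
  obtain f where "f \<in> isos C A A'"
    using assms unfolding isomorphic_def by blast
  then obtain g where fg: "g \<in> Hom C A' A" "f \<in> Hom C A A'" "g \<cdot> f = idn C A" "f \<cdot> g = idn C A'"
    by (rule isos_inverse)
  have "bij_betw (\<lambda>k. k \<cdot> g) (Hom C A B) (Hom C A' B)"
  proof (rule bij_betw_byWitness[where f' = "\<lambda>k. k \<cdot> f"])
    show "\<forall>k\<in>Hom C A B. (k \<cdot> g) \<cdot> f = k"
      using fg(3) cmp_assoc[OF fg(2) fg(1)] idn_right by auto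
    show "\<forall>k\<in>Hom C A' B. (k \<cdot> f) \<cdot> g = k"
      using fg(4) cmp_assoc[OF fg(1) fg(2)] idn_right by auto
  qed (use cmp_Hom[OF fg(1)] cmp_Hom[OF fg(2)] cmp_Hom[OF _ fg(1)] cmp_Hom[OF _ fg(2)] in auto)
  then show ?thesis
    by (rule orthogonal_cong_bij)
qed

lemma orthogonal_cong_right:
  assumes "isomorphic C B B'"
  shows "orthogonal C A B \<longleftrightarrow> orthogonal C A B'"
proof -
  obtain f where "f \<in> isos C B B'"
    using assms unfolding isomorphic_def by blast
  then obtain g where fg: "g \<in> Hom C B' B" "f \<in> Hom C B B'" "g \<cdot> f = idn C B" "f \<cdot> g = idn C B'"
    by (rule isos_inverse)
  have "bij_betw (\<lambda>k. f \<cdot> k) (Hom C A B) (Hom C A B')"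
  proof (rule bij_betw_byWitness[where f' = "\<lambda>k. g \<cdot> k"])
    show "\<forall>k\<in>Hom C A B. g \<cdot> (f \<cdot> k) = k"
      using fg(3) cmp_assoc[OF _ fg(2) fg(1)] idn_left by fastforce
    show "\<forall>k\<in>Hom C A B'. f \<cdot> (g \<cdot> k) = k"
      using fg(4) cmp_assoc[OF _ fg(1) fg(2)] idn_left by fastforce
  qed (use cmp_Hom[OF fg(1)] cmp_Hom[OF fg(2)] cmp_Hom[OF _ fg(1)] cmp_Hom[OF _ fg(2)] in auto)
  then show ?thesis
    by (rule orthogonal_cong_bij)
qed

text \<open>Arrows into a product are determined by their components, so two arrows from \<open>D\<close> into a
  product of objects orthogonal to \<open>D\<close> agree.\<close>

lemma orthogonal_product:
  assumes "is_product C I B Q pr" and "\<And>i. i \<in> I \<Longrightarrow> orthogonal C D (B i)"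
  shows "orthogonal C D Q"
proof -
  define f where "f i = the_elem (Hom C D (B i))" for i
  have f: "Hom C D (B i) = {f i}" if "i \<in> I" for i
    using assms(2)[OF that] unfolding orthogonal_def f_def by (simp add: is_singleton_the_elem)
  then have "\<forall>i\<in>I. f i \<in> Hom C D (B i)"
    by blast
  then obtain h where h: "h \<in> Hom C D Q"
    and u: "\<And>k. k \<in> Hom C D Q \<Longrightarrow> \<forall>i\<in>I. pr i \<cdot> k = f i \<Longrightarrow> k = h"
    using assms(1) unfolding is_product_def by metis
  have "pr i \<cdot> k = f i" if "k \<in> Hom C D Q" "i \<in> I" for k i
    using cmp_Hom[OF that(1), of "pr i" "B i"] assms(1) f that unfolding is_product_def by blast
  then have "Hom C D Q = {h}"
    using h u by blast
  then show ?thesis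
    unfolding orthogonal_def by simp
qed

end

context additive_category
begin

lemma zmor_Hom: "zmor C A B \<in> Hom C A B"
  using monoid.one_closed[OF comm_group.axioms(2)[OF hom_comm_group, THEN group.axioms(1)], of A B]
  unfolding hom_group_def by simp

lemma padd_idempotent:
  assumes "f \<in> Hom C A B" "padd C f f = f"
  shows "f = zmor C A B"
  using group.l_cancel_one'[OF comm_group.axioms(2)[OF hom_comm_group], of f A B f] assms
  unfolding hom_group_def by simp

lemma zmor_padd: "padd C (zmor C A B) (zmor C A B) = zmor C A B"
  using monoid.l_one[OF comm_group.axioms(2)[OF hom_comm_group, THEN group.axioms(1)],
      of "zmor C A B" A B] zmor_Hom
  unfolding hom_group_def by simp

lemma cmp_zmor_right:
  assumes "g \<in> Hom C B D"
  shows "g \<cdot> zmor C A B = zmor C A D"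
  using cmp_padd_right[OF zmor_Hom zmor_Hom assms, of A]
  by (intro padd_idempotent[OF cmp_Hom[OF zmor_Hom assms]]) (simp add: zmor_padd)

lemma cmp_zmor_left:
  assumes "f \<in> Hom C A B"
  shows "zmor C B D \<cdot> f = zmor C A D"
  using cmp_padd_left[OF assms zmor_Hom zmor_Hom, of D]
  by (intro padd_idempotent[OF cmp_Hom[OF assms zmor_Hom]]) (simp add: zmor_padd)

lemma orthogonal_iff_zmor: "orthogonal C A B \<longleftrightarrow> (\<forall>f\<in>Hom C A B. f = zmor C A B)"
  unfolding orthogonal_def is_singleton_def using zmor_Hom[of A B]
  by (auto intro: exI[of _ "zmor C A B"])

lemma zero_obj_iff_idn: "zero_obj C Z \<longleftrightarrow> idn C Z = zmor C Z Z"
proof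
  assume "zero_obj C Z"
  then show "idn C Z = zmor C Z Z"
    using idn_Hom zmor_Hom unfolding zero_obj_def by blast
next
  assume eq: "idn C Z = zmor C Z Z"
  have "f = zmor C Z A" if "f \<in> Hom C Z A" for f A
    using idn_right[OF that] cmp_zmor_right[OF that, of Z] eq by simp
  moreover have "f = zmor C A Z" if "f \<in> Hom C A Z" for f A
    using idn_left[OF that] cmp_zmor_left[OF that, of Z] eq by simp
  ultimately show "zero_obj C Z"
    unfolding zero_obj_def using zmor_Hom by blast
qed

lemma zero_obj_iff_orthogonal: "zero_obj C Z \<longleftrightarrow> (\<forall>A. orthogonal C A Z)"
proof
  assume "zero_obj C Z"
  then show "\<forall>A. orthogonal C A Z"
    using zmor_Hom unfolding zero_obj_def orthogonal_iff_zmor by blast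
next
  assume "\<forall>A. orthogonal C A Z"
  then show "zero_obj C Z"
    using idn_Hom[of Z] unfolding zero_obj_iff_idn orthogonal_iff_zmor by blast
qed

lemma orthogonal_zero_obj_left: "zero_obj C Z \<Longrightarrow> orthogonal C Z B"
  using zmor_Hom[of Z B] unfolding zero_obj_def orthogonal_iff_zmor by blast

lemma nmor_eq_zmor_iff:
  assumes "f \<in> Hom C A B"
  shows "nmor C f = zmor C A B \<longleftrightarrow> f = zmor C A B"
proof -
  interpret G: group "hom_group C A B"
    by (rule comm_group.axioms(2)[OF hom_comm_group])
  have "f \<in> carrier (hom_group C A B)" "src C f = A" "tgt C f = B"
    and one: "\<one>\<^bsub>hom_group C A B\<^esub> = zmor C A B"
    using assms unfolding hom_group_def Hom_def by simp_all
  then show ?thesis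
    using G.inv_eq_1_iff[of f] unfolding nmor_def by simp
qed

lemma nmor_Hom:
  assumes "f \<in> Hom C A B"
  shows "nmor C f \<in> Hom C A B"
proof -
  interpret G: group "hom_group C A B"
    by (rule comm_group.axioms(2)[OF hom_comm_group])
  show ?thesis
    using assms G.inv_closed[of f] unfolding nmor_def hom_group_def Hom_def by simp
qed

lemma cmp_nmor_right:
  assumes "f \<in> Hom C A B" "g \<in> Hom C B D"
  shows "g \<cdot> nmor C f = nmor C (g \<cdot> f)"
proof -
  interpret G: comm_group "hom_group C A B"
    by (rule hom_comm_group)
  interpret G': comm_group "hom_group C A D"
    by (rule hom_comm_group)
  have "padd C (nmor C f) f = zmor C A B"
    using G.l_inv[of f] assms(1) unfolding nmor_def hom_group_def Hom_def by auto
  then have "padd C (g \<cdot> nmor C f) (g \<cdot> f) = zmor C A D"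
    using cmp_padd_right[OF nmor_Hom[OF assms(1)] assms(1) assms(2)] cmp_zmor_right[OF assms(2), of A]
    by simp
  moreover have "g \<cdot> f \<in> Hom C A D" "g \<cdot> nmor C f \<in> Hom C A D"
    using assms cmp_Hom nmor_Hom by blast+
  ultimately have "g \<cdot> nmor C f = inv\<^bsub>hom_group C A D\<^esub> (g \<cdot> f)"
    using G'.inv_equality[of "g \<cdot> nmor C f" "g \<cdot> f"] unfolding hom_group_def by simp
  then show ?thesis
    using \<open>g \<cdot> f \<in> Hom C A D\<close> unfolding nmor_def Hom_def by simp
qed

end

lemma additive_functor_zmor:
  assumes C: "additive_category C" and D: "additive_category D"
    and F: "additive_functor C D FO FM"
  shows "FM (zmor C A B) = zmor D (FO A) (FO B)"
proof (rule additive_category.padd_idempotent[OF D])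
  have z: "zmor C A B \<in> Hom C A B"
    by (rule additive_category.zmor_Hom[OF C])
  then show "FM (zmor C A B) \<in> Hom D (FO A) (FO B)"
    using F unfolding additive_functor_def is_functor_def by blast
  show "padd D (FM (zmor C A B)) (FM (zmor C A B)) = FM (zmor C A B)"
    using F z additive_category.zmor_padd[OF C, of A B] unfolding additive_functor_def by metis
qed

lemma additive_functor_zero_obj:
  assumes C: "additive_category C" and D: "additive_category D"
    and F: "additive_functor C D FO FM" and Z: "zero_obj C Z"
  shows "zero_obj D (FO Z)"
proof -
  have "idn D (FO Z) = FM (idn C Z)"
    using F unfolding additive_functor_def is_functor_def by simp
  also have "\<dots> = zmor D (FO Z) (FO Z)"
    using additive_functor_zmor[OF C D F] Z additive_category.zero_obj_iff_idn[OF C] by metis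
  finally show ?thesis
    by (simp add: additive_category.zero_obj_iff_idn[OF D])
qed

lemma functor_isomorphic:
  assumes C: "category C" and D: "category D" and F: "is_functor C D FO FM"
    and "isomorphic C A B"
  shows "isomorphic D (FO A) (FO B)"
proof -
  obtain f where "f \<in> isos C A B"
    using assms unfolding isomorphic_def by blast
  then obtain g where "g \<in> Hom C B A" "f \<in> Hom C A B" "g \<cdot>\<^bsub>C\<^esub> f = idn C A" "f \<cdot>\<^bsub>C\<^esub> g = idn C B"
    by (rule category.isos_inverse[OF C])
  then have "FM f \<in> isos D (FO A) (FO B)"
    using F unfolding is_functor_def
    by (intro category.isosI[OF D, of "FM f" _ _ "FM g"]) (simp_all, metis+)
  then show ?thesis
    unfolding isomorphic_def by blast
qed

context triangulated_category
begin

lemma orthogonal_sus: "orthogonal C (sus C A) (sus C B) \<longleftrightarrow> orthogonal C A B"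
  using orthogonal_cong_bij[OF sus_fully_faithful] by blast

text \<open>The suspension is faithful and additive.\<close>

lemma susm_eq_zmor:
  assumes "u \<in> Hom C A B" "susm C u = zmor C (sus C A) (sus C B)"
  shows "u = zmor C A B"
proof (rule inj_onD[OF bij_betw_imp_inj_on[OF sus_fully_faithful] _ assms(1) zmor_Hom])
  show "susm C u = susm C (zmor C A B)"
    using additive_functor_zmor[OF additive_category_axioms additive_category_axioms sus_additive]
      assms(2) by simp
qed

text \<open>
  This is the exactness of \<open>Hom(D,-)\<close> at the third vertex \<open>Z\<close> of a triangle. An arrow \<open>u\<close> from
  \<open>D\<close> to \<open>Z\<close> is killed by \<open>h\<close>, so it extends to a map of triangles; the next component
  of that map starts at \<open>\<Sigma>D\<close> and ends at \<open>\<Sigma>Y\<close>, hence is zero, and it determines \<open>\<Sigma>u\<close> up to sign.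
\<close>

lemma orthogonal_cone:
  assumes t: "(f, g, h) \<in> tri C"
    and Y: "orthogonal C D (tgt C f)" and sX: "orthogonal C D (sus C (src C f))"
  shows "orthogonal C D (tgt C g)"
  unfolding orthogonal_iff_zmor
proof
  fix u
  assume u: "u \<in> Hom C D (tgt C g)"
  define X Y Z where "X = src C f" and "Y = tgt C f" and "Z = tgt C g"
  have f: "f \<in> Hom C X Y" and g: "g \<in> Hom C Y Z" and h: "h \<in> Hom C Z (sus C X)"
    using tri_wf[OF t] unfolding Hom_def X_def Y_def Z_def by simp_all
  have susm_Hom: "susm C k \<in> Hom C (sus C A) (sus C B)" if "k \<in> Hom C A B" for k A B
    using that bij_betwE[OF sus_fully_faithful] by blast
  obtain O' where O': "zero_obj C O'"
    using ex_zero_obj by blast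
  \<comment> \<open>The map of triangles is built on \<open>D \<rightarrow> 0 \<rightarrow> \<Sigma>D\<close> and \<open>Z \<rightarrow> \<Sigma>X \<rightarrow> \<Sigma>Y\<close>, rotated
     so that \<open>u\<close> sits at the first vertex.\<close>
  have tD: "(zmor C D O', zmor C O' (sus C D), nmor C (susm C (idn C D))) \<in> tri C"
    using TR2[OF idn_Hom zmor_Hom zmor_Hom] TR1_idn[OF O'] by blast
  have t2: "(h, nmor C (susm C f), nmor C (susm C g)) \<in> tri C"
    using TR2[OF f g h] TR2[OF g h nmor_Hom[OF susm_Hom[OF f]]] t by blast
  have hu: "h \<cdot> u = zmor C D (sus C X)"
    using cmp_Hom[OF u[folded Z_def] h] sX unfolding orthogonal_iff_zmor X_def by blast
  have "zmor C O' (sus C X) \<cdot> zmor C D O' = h \<cdot> u"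
    using hu cmp_zmor_right[OF zmor_Hom, of O' "sus C X" D] by simp
  then obtain w where w: "w \<in> Hom C (sus C D) (sus C Y)"
    and eq: "susm C u \<cdot> nmor C (susm C (idn C D)) = nmor C (susm C g) \<cdot> w"
    using TR3[OF tD t2, of u "zmor C O' (sus C X)"] u h nmor_Hom[OF susm_Hom[OF f]]
      nmor_Hom[OF susm_Hom[OF g]] nmor_Hom[OF susm_Hom[OF idn_Hom[of D]]]
      zmor_Hom[of D O'] zmor_Hom[of O' "sus C D"] zmor_Hom[of O' "sus C X"]
    unfolding Hom_def Z_def by auto
  have "w = zmor C (sus C D) (sus C Y)"
    using w Y orthogonal_sus[of D Y] unfolding orthogonal_iff_zmor Y_def by blast
  then have "nmor C (susm C u \<cdot> susm C (idn C D)) = zmor C (sus C D) (sus C Z)"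
    using eq cmp_nmor_right[OF susm_Hom[OF idn_Hom] susm_Hom[OF u[folded Z_def]]]
      cmp_zmor_right[OF nmor_Hom[OF susm_Hom[OF g]], of "sus C D"] by simp
  moreover have "susm C (idn C D) = idn C (sus C D)"
    using sus_additive unfolding additive_functor_def is_functor_def by blast
  ultimately have "susm C u = zmor C (sus C D) (sus C Z)"
    using nmor_eq_zmor_iff[OF susm_Hom[OF u[folded Z_def]]]
      idn_right[OF susm_Hom[OF u[folded Z_def]]] by simp
  then show "u = zmor C D (tgt C g)"
    using susm_eq_zmor u unfolding Z_def by blast
qed

text \<open>Stability of \<open>\<D>\<close> under suspension and desuspension, up to isomorphism, is what makes its
  right orthogonal invariant under both.\<close>

lemma triangulated_subcategory_right_orthogonal:
  assumes sus_closed: "\<And>D. D \<in> \<D> \<Longrightarrow> \<exists>D'\<in>\<D>. isomorphic C D' (sus C D)"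
    and desus_closed: "\<And>D. D \<in> \<D> \<Longrightarrow> \<exists>D'\<in>\<D>. isomorphic C D (sus C D')"
  shows "triangulated_subcategory C {B. \<forall>D\<in>\<D>. orthogonal C D B}"
proof -
  have sus_iff: "(\<forall>D\<in>\<D>. orthogonal C D (sus C B)) \<longleftrightarrow> (\<forall>D\<in>\<D>. orthogonal C D B)" for B
  proof (intro iffI ballI)
    fix D
    assume "\<forall>D\<in>\<D>. orthogonal C D (sus C B)" "D \<in> \<D>"
    then show "orthogonal C D B"
      using sus_closed orthogonal_cong_left orthogonal_sus by metis
  next
    fix D
    assume "\<forall>D\<in>\<D>. orthogonal C D B" "D \<in> \<D>"
    then show "orthogonal C D (sus C B)"
      using desus_closed orthogonal_cong_left orthogonal_sus by metis
  qed
  show ?thesis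
    unfolding triangulated_subcategory_def mem_Collect_eq
  proof (intro conjI allI impI)
    show "\<forall>D\<in>\<D>. orthogonal C D B" if "\<forall>D\<in>\<D>. orthogonal C D A" "isomorphic C A B" for A B
      using that orthogonal_cong_right by blast
    show "\<forall>D\<in>\<D>. orthogonal C D (tgt C g)"
      if "(f, g, h) \<in> tri C" "\<forall>D\<in>\<D>. orthogonal C D (src C f)"
        "\<forall>D\<in>\<D>. orthogonal C D (tgt C f)" for f g h
      using that sus_iff orthogonal_cone by blast
  qed (simp_all add: sus_iff zero_obj_iff_orthogonal)
qed

end

section \<open>The functors \<open>[X,-]\<^sub>\<star>\<close> and their kernels\<close>

locale tt_module_with_hom = TT: tt_category U T P e br + KK: triangulated_category K +
    act: tt_action U T P e br K M
  for U :: "'u itself"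
    and T :: "('to, 'tm, 'z) tricat_scheme"
    and P :: "('to, 'tm, 'to, 'tm) action"
    and e :: 'to
    and br :: "'to \<Rightarrow> 'to \<Rightarrow> 'tm"
    and K :: "('ko, 'km, 'y) tricat_scheme"
    and M :: "('to, 'tm, 'ko, 'km) action" +
  fixes H :: "'to \<Rightarrow> 'ko \<Rightarrow> 'ko" and Hm :: "'to \<Rightarrow> 'km \<Rightarrow> 'km"
  assumes hom: "internal_hom T K M H Hm"
begin

lemma orthogonal_hom: "orthogonal K D (H X A) \<longleftrightarrow> orthogonal K (X \<star>\<^bsub>M\<^esub> D) A"
  using hom orthogonal_cong_bij unfolding internal_hom_def right_adjoint_def by metis

text \<open>The kernel of \<open>[X,-]\<^sub>\<star>\<close> is the right orthogonal of the image of \<open>X \<star> -\<close>. This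
  reduces statements about the kernel to statements about the action.\<close>

lemma hom_zero_iff: "zero_obj K (H X A) \<longleftrightarrow> (\<forall>D. orthogonal K (X \<star>\<^bsub>M\<^esub> D) A)"
  by (simp add: KK.zero_obj_iff_orthogonal orthogonal_hom)

lemma additive1: "additive_functor T K (\<lambda>X. X \<star>\<^bsub>M\<^esub> A) (\<lambda>u. arr M u (idn K A))"
  using act.triangulated1 unfolding triangulated_functor_def by blast

lemma action_isomorphic:
  assumes "isomorphic T X Y"
  shows "isomorphic K (X \<star>\<^bsub>M\<^esub> A) (Y \<star>\<^bsub>M\<^esub> A)"
  using functor_isomorphic[OF TT.category_axioms KK.category_axioms _ assms] additive1
  unfolding additive_functor_def by blast

lemma hom_zero_cong:
  assumes "isomorphic T X Y"
  shows "zero_obj K (H X A) \<longleftrightarrow> zero_obj K (H Y A)"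
  using KK.orthogonal_cong_left[OF action_isomorphic[OF assms]] by (simp add: hom_zero_iff)

lemma hom_zero_left:
  assumes "zero_obj T X"
  shows "zero_obj K (H X A)"
  using additive_functor_zero_obj[OF TT.additive_category_axioms KK.additive_category_axioms
      additive1 assms] KK.orthogonal_zero_obj_left
  unfolding hom_zero_iff by blast

lemma braiding_isomorphic: "isomorphic T (X \<star>\<^bsub>P\<^esub> Y) (Y \<star>\<^bsub>P\<^esub> X)"
  using TT.isosI[OF TT.br_Hom TT.br_Hom TT.br_symmetric TT.br_symmetric]
  unfolding isomorphic_def by blast

text \<open>By adjunction both sides say that \<open>A\<close> receives only zero arrows from the objects
  \<open>Y \<star> (X \<star> D) \<cong> (Y \<otimes> X) \<star> D\<close>.\<close>

lemma hom_hom_zero_iff: "zero_obj K (H X (H Y A)) \<longleftrightarrow> zero_obj K (H (Y \<star>\<^bsub>P\<^esub> X) A)"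
proof -
  have "isomorphic K ((Y \<star>\<^bsub>P\<^esub> X) \<star>\<^bsub>M\<^esub> D) (Y \<star>\<^bsub>M\<^esub> X \<star>\<^bsub>M\<^esub> D)" for D
    using act.assoc_iso unfolding isomorphic_def by blast
  then show ?thesis
    unfolding hom_zero_iff orthogonal_hom using KK.orthogonal_cong_left by blast
qed

lemma hom_hom_zero_commute: "zero_obj K (H X (H Y A)) \<longleftrightarrow> zero_obj K (H Y (H X A))"
  unfolding hom_hom_zero_iff by (rule hom_zero_cong[OF braiding_isomorphic])

lemma hom_zero_right: "zero_obj K A \<Longrightarrow> zero_obj K (H X A)"
  using KK.zero_obj_iff_orthogonal hom_zero_iff by blast

text \<open>Right orthogonals are closed under products, the objects \<open>X \<star> D\<close> are stable under
  suspension and desuspension, and closure under \<open>[Y,-]\<^sub>\<star>\<close> comes from commuting it past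
  \<open>[X,-]\<^sub>\<star>\<close>.\<close>

lemma ker_hom_in_Coloc_hom: "ker_hom K H X \<in> Coloc_hom U K H"
proof -
  let ?\<D> = "range (\<lambda>D. X \<star>\<^bsub>M\<^esub> D)"
  have ker: "ker_hom K H X = {B. \<forall>D\<in>?\<D>. orthogonal K D B}"
    unfolding ker_hom_def by (simp add: hom_zero_iff)
  have sus: "isomorphic K (X \<star>\<^bsub>M\<^esub> sus K D) (sus K (X \<star>\<^bsub>M\<^esub> D))" for D
    using act.triangulated2[of X] unfolding triangulated_functor_def isomorphic_def by blast
  have fun2: "is_functor K K (\<lambda>A. X \<star>\<^bsub>M\<^esub> A) (\<lambda>f. arr M (idn T X) f)"
    using act.triangulated2[of X] unfolding triangulated_functor_def additive_functor_def by blast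
  have "triangulated_subcategory K (ker_hom K H X)"
    unfolding ker
  proof (rule KK.triangulated_subcategory_right_orthogonal)
    fix D'
    assume "D' \<in> ?\<D>"
    then obtain D where D: "D' = X \<star>\<^bsub>M\<^esub> D"
      by blast
    then show "\<exists>E\<in>?\<D>. isomorphic K E (sus K D')"
      using sus by blast
    obtain E where "isomorphic K (sus K E) D"
      using KK.sus_ess_surj by blast
    then have "isomorphic K D' (X \<star>\<^bsub>M\<^esub> sus K E)"
      unfolding D
      using functor_isomorphic[OF KK.category_axioms KK.category_axioms fun2] KK.isomorphic_sym
      by blast
    then show "\<exists>E\<in>?\<D>. isomorphic K D' (sus K E)"
      using sus KK.isomorphic_trans by blast
  qed
  moreover have "Q \<in> ker_hom K H X" if "is_product K I B Q pr" "\<forall>i\<in>I. B i \<in> ker_hom K H X"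
    for I :: "'u set" and B Q pr
    using KK.orthogonal_product[OF that(1)] that(2) unfolding ker by blast
  moreover have "H Y A \<in> ker_hom K H X" if "A \<in> ker_hom K H X" for Y A
    using that hom_hom_zero_commute hom_zero_right unfolding ker_hom_def by blast
  ultimately show ?thesis
    unfolding Coloc_hom_def by blast
qed

end

lemma UNIV_in_Coloc_hom: "UNIV \<in> Coloc_hom U K H"
  unfolding Coloc_hom_def triangulated_subcategory_def by simp

section \<open>Costratified modules and hom-primes\<close>

locale costratified_module = tt_module_with_hom U T P e br K M H Hm
  for U :: "'u itself"
    and T :: "('to, 'tm, 'z) tricat_scheme"
    and P :: "('to, 'tm, 'to, 'tm) action"
    and e :: 'to
    and br :: "'to \<Rightarrow> 'to \<Rightarrow> 'tm"
    and K :: "('ko, 'km, 'y) tricat_scheme"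
    and M :: "('to, 'tm, 'ko, 'km) action"
    and H :: "'to \<Rightarrow> 'ko \<Rightarrow> 'ko"
    and Hm :: "'to \<Rightarrow> 'km \<Rightarrow> 'km" +
  fixes S :: "'s topology" and \<Gamma> :: "'s \<Rightarrow> 'to" and I_K :: 'ko
  assumes good: "good T P S \<Gamma>"
    and costrat: "costratified U K H S \<Gamma> I_K"
begin

abbreviation csupp :: "'ko \<Rightarrow> 's set" where
  "csupp A \<equiv> cosupp K H S \<Gamma> A"

lemma costratified_Coloc_eq: "C \<in> Coloc_hom U K H \<Longrightarrow> {A. csupp A \<subseteq> (\<Union>B\<in>C. csupp B)} = C"
  using costrat unfolding costratified_def Let_def by (elim conjE) (rule bspec)

lemma costratified_support: "C \<in> Coloc_hom U K H \<Longrightarrow> (\<Union>B\<in>C. csupp B) \<subseteq> csupp I_K"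
  using costrat unfolding costratified_def Let_def by (elim conjE) (drule (1) funcset_mem, simp)

lemma cosupp_subset: "csupp A \<subseteq> csupp I_K"
  using costratified_support[OF UNIV_in_Coloc_hom] by blast

lemma in_ker_hom_iff: "s \<in> topspace S \<Longrightarrow> A \<in> ker_hom K H (\<Gamma> s) \<longleftrightarrow> s \<notin> csupp A"
  unfolding ker_hom_def cosupp_def by simp

text \<open>Orthogonality of the \<open>\<Gamma>\<^sub>r\<close> removes the points other than \<open>s\<close>, and idempotence of
  \<open>\<Gamma>\<^sub>s\<close> keeps \<open>s\<close>.\<close>

lemma cosupp_hom_point:
  assumes s: "s \<in> topspace S"
  shows "csupp (H (\<Gamma> s) A) = csupp A \<inter> {s}"
proof -
  have "zero_obj K (H (\<Gamma> r) (H (\<Gamma> s) A))" if "r \<in> topspace S" "r \<noteq> s" for r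
    using good that s hom_zero_left[of "\<Gamma> s \<star>\<^bsub>P\<^esub> \<Gamma> r"] unfolding good_def hom_hom_zero_iff by metis
  moreover have "zero_obj K (H (\<Gamma> s) (H (\<Gamma> s) A)) \<longleftrightarrow> zero_obj K (H (\<Gamma> s) A)"
    unfolding hom_hom_zero_iff using good s
    by (intro hom_zero_cong) (simp add: good_def)
  ultimately show ?thesis
    using s unfolding cosupp_def by auto
qed

text \<open>A submodule is determined by the union of the cosupports of its objects, so to contain
  \<open>Ker [\<Gamma>\<^sub>s,-]\<^sub>\<star>\<close> it suffices that this union contains \<open>csupp I_K - {s}\<close>.\<close>

lemma ker_hom_point_subset:
  assumes C: "C \<in> Coloc_hom U K H" and s: "s \<in> topspace S"
    and gen: "\<And>r. r \<in> csupp I_K \<Longrightarrow> r \<noteq> s \<Longrightarrow> \<exists>A\<in>C. r \<in> csupp A"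
  shows "ker_hom K H (\<Gamma> s) \<subseteq> C"
proof
  fix A
  assume "A \<in> ker_hom K H (\<Gamma> s)"
  then have "csupp A \<subseteq> (\<Union>B\<in>C. csupp B)"
    using gen cosupp_subset in_ker_hom_iff[OF s] by blast
  then show "A \<in> C"
    using costratified_Coloc_eq[OF C] by blast
qed

lemma cosupp_topspace: "s \<in> csupp A \<Longrightarrow> s \<in> topspace S"
  unfolding cosupp_def by simp

text \<open>Primeness is minimality of the submodule of objects with cosupport in \<open>{s}\<close>, applied to the
  submodule \<open>Ker [X,-]\<^sub>\<star>\<close>.\<close>

lemma hom_prime_ker_hom_point:
  assumes s: "s \<in> csupp I_K"
  shows "hom_prime U K H (ker_hom K H (\<Gamma> s))"
  unfolding hom_prime_def
proof (intro conjI allI impI)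
  note sS = cosupp_topspace[OF s]
  show "ker_hom K H (\<Gamma> s) \<in> Coloc_hom U K H"
    by (rule ker_hom_in_Coloc_hom)
  show "ker_hom K H (\<Gamma> s) \<noteq> UNIV"
    using s in_ker_hom_iff[OF sS] by blast
  fix X A
  assume XA: "H X A \<in> ker_hom K H (\<Gamma> s)"
  show "X \<in> C_otimes H (ker_hom K H (\<Gamma> s)) \<or> A \<in> ker_hom K H (\<Gamma> s)"
  proof (rule disjCI)
    assume "A \<notin> ker_hom K H (\<Gamma> s)"
    then have "s \<in> csupp (H (\<Gamma> s) A)"
      using cosupp_hom_point[OF sS] in_ker_hom_iff[OF sS] by blast
    moreover have "H (\<Gamma> s) A \<in> ker_hom K H X"
      using XA hom_hom_zero_commute unfolding ker_hom_def by blast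
    ultimately have "{B. csupp B \<subseteq> {s}} \<subseteq> ker_hom K H X"
      using costratified_Coloc_eq[OF ker_hom_in_Coloc_hom[of X]] by blast
    then have "H (\<Gamma> s) B \<in> ker_hom K H X" for B
      using cosupp_hom_point[OF sS] by blast
    then show "X \<in> C_otimes H (ker_hom K H (\<Gamma> s))"
      using hom_hom_zero_commute unfolding ker_hom_def C_otimes_def by blast
  qed
qed

text \<open>A point of the cosupport of \<open>I_K\<close> lies in no cosupport of an object of \<open>C\<close>, since \<open>C\<close> is
  proper; a second such point would contradict primeness, as \<open>[\<Gamma>\<^sub>s,[\<Gamma>\<^sub>r,I_K]\<^sub>\<star>]\<^sub>\<star>\<close> vanishes for \<open>s \<noteq> r\<close>.\<close>

lemma hom_prime_is_ker_hom_point: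
  assumes prime: "hom_prime U K H C"
  obtains s where "s \<in> csupp I_K" "C = ker_hom K H (\<Gamma> s)"
proof -
  have C: "C \<in> Coloc_hom U K H" and proper: "C \<noteq> UNIV"
    and pr: "\<And>X A. H X A \<in> C \<Longrightarrow> X \<in> C_otimes H C \<or> A \<in> C"
    using prime unfolding hom_prime_def by blast+
  define W where "W = (\<Union>A\<in>C. csupp A)"
  have C_eq: "C = {A. csupp A \<subseteq> W}"
    using costratified_Coloc_eq[OF C] unfolding W_def by simp
  obtain s where s: "s \<in> csupp I_K" "s \<notin> W"
    using proper cosupp_subset unfolding C_eq by blast
  note sS = cosupp_topspace[OF s(1)]
  have "r \<in> W" if r: "r \<in> csupp I_K" "r \<noteq> s" for r
  proof (rule ccontr)
    assume "r \<notin> W"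
    note rS = cosupp_topspace[OF r(1)]
    have "H (\<Gamma> s) (H (\<Gamma> r) I_K) \<in> C"
      using cosupp_hom_point[OF sS] cosupp_hom_point[OF rS] r(2) unfolding C_eq by auto
    moreover have "H (\<Gamma> r) I_K \<notin> C"
      using cosupp_hom_point[OF rS] r \<open>r \<notin> W\<close> unfolding C_eq by auto
    moreover have "\<Gamma> s \<notin> C_otimes H C"
      using cosupp_hom_point[OF sS] s unfolding C_otimes_def C_eq by auto
    ultimately show False
      using pr by blast
  qed
  then have "C = ker_hom K H (\<Gamma> s)"
    using s cosupp_subset in_ker_hom_iff[OF sS] unfolding C_eq by blast
  then show ?thesis
    using that s(1) by blast
qed

text \<open>For \<open>s \<noteq> r\<close> the object \<open>[\<Gamma>\<^sub>r,I_K]\<^sub>\<star>\<close>, whose cosupport is \<open>{r}\<close>, separates the two kernels.\<close>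

lemma ker_hom_point_eq_iff:
  assumes "s \<in> csupp I_K" "r \<in> csupp I_K"
  shows "ker_hom K H (\<Gamma> s) = ker_hom K H (\<Gamma> r) \<longleftrightarrow> s = r"
proof
  assume eq: "ker_hom K H (\<Gamma> s) = ker_hom K H (\<Gamma> r)"
  note S = assms[THEN cosupp_topspace]
  show "s = r"
  proof (rule ccontr)
    assume "s \<noteq> r"
    then have "H (\<Gamma> r) I_K \<in> ker_hom K H (\<Gamma> s)" "H (\<Gamma> r) I_K \<notin> ker_hom K H (\<Gamma> r)"
      using in_ker_hom_iff S cosupp_hom_point assms by auto
    then show False
      using eq by blast
  qed
qed simp

lemma ker_hom_point_generated:
  assumes s: "s \<in> csupp I_K"
  shows "ker_hom K H (\<Gamma> s) = coloc_hom U K H {H (\<Gamma> r) I_K | r. r \<in> topspace S \<and> r \<noteq> s}"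
    (is "_ = coloc_hom U K H ?\<A>")
proof
  note sS = cosupp_topspace[OF s]
  have "?\<A> \<subseteq> ker_hom K H (\<Gamma> s)"
    using in_ker_hom_iff[OF sS] cosupp_hom_point by auto
  then show "coloc_hom U K H ?\<A> \<subseteq> ker_hom K H (\<Gamma> s)"
    unfolding coloc_hom_def using ker_hom_in_Coloc_hom by blast
  show "ker_hom K H (\<Gamma> s) \<subseteq> coloc_hom U K H ?\<A>"
    unfolding coloc_hom_def
  proof (rule Inter_greatest)
    fix C
    assume "C \<in> {C \<in> Coloc_hom U K H. ?\<A> \<subseteq> C}"
    then have C: "C \<in> Coloc_hom U K H" "?\<A> \<subseteq> C"
      by blast+
    show "ker_hom K H (\<Gamma> s) \<subseteq> C"
    proof (rule ker_hom_point_subset[OF C(1) sS])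
      fix r
      assume "r \<in> csupp I_K" "r \<noteq> s"
      then have "H (\<Gamma> r) I_K \<in> C" "r \<in> csupp (H (\<Gamma> r) I_K)"
        using C(2) cosupp_topspace cosupp_hom_point by auto
      then show "\<exists>A\<in>C. r \<in> csupp A"
        by blast
    qed
  qed
qed

lemma bij_betw_points_hom_primes:
  "bij_betw (\<lambda>s. ker_hom K H (\<Gamma> s)) (csupp I_K) {C. hom_prime U K H C}"
  unfolding bij_betw_def
proof
  show "inj_on (\<lambda>s. ker_hom K H (\<Gamma> s)) (csupp I_K)"
    using ker_hom_point_eq_iff by (auto intro: inj_onI)
  show "(\<lambda>s. ker_hom K H (\<Gamma> s)) ` csupp I_K = {C. hom_prime U K H C}"
    using hom_prime_ker_hom_point hom_prime_is_ker_hom_point by blast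
qed

end

theorem theorem4p10:
  fixes U :: "'u itself"
    and T :: "('to, 'tm, 'z) tricat_scheme"
    and P :: "('to, 'tm, 'to, 'tm) action"
    and e :: 'to
    and br :: "'to \<Rightarrow> 'to \<Rightarrow> 'tm"
    and S :: "'s topology"
    and \<Gamma> :: "'s \<Rightarrow> 'to"
    and K :: "('ko, 'km, 'y) tricat_scheme"
    and M :: "('to, 'tm, 'ko, 'km) action"
    and H :: "'to \<Rightarrow> 'ko \<Rightarrow> 'ko"
    and Hm :: "'to \<Rightarrow> 'km \<Rightarrow> 'km"
    and I_K :: 'ko
  assumes "big_tt_category U T P e br"
    and "good T P S \<Gamma>"
    and "tt_module U T P e br K M"
    and "internal_hom T K M H Hm"
    and "brown_comenetz_product U K I_K"
    and "costratified U K H S \<Gamma> I_K"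
  shows "bij_betw (\<lambda>s. ker_hom K H (\<Gamma> s)) (cosupp K H S \<Gamma> I_K) {C. hom_prime U K H C} \<and>
    (\<forall>s \<in> cosupp K H S \<Gamma> I_K.
      ker_hom K H (\<Gamma> s) = coloc_hom U K H {H (\<Gamma> r) I_K | r. r \<in> topspace S \<and> r \<noteq> s})"
proof -
  interpret costratified_module U T P e br K M H Hm S \<Gamma> I_K
    using assms
    unfolding big_tt_category_def tt_module_def compactly_generated_def
    by (intro costratified_module.intro tt_module_with_hom.intro
        tt_module_with_hom_axioms.intro costratified_module_axioms.intro) simp_all
  show ?thesis
    using bij_betw_points_hom_primes ker_hom_point_generated by blast
qed

end
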